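(* For every large enough $n$, there exist an invertible positive semidefinite matrix $S\in\mathbb{R}^{n\times n}$ with sparsity $d=O(1)$ (bounded uniformly in $n$) and condition number $\kappa(S)\le 3$, and a distinguished index $u\in[n]$, with the following property. Every randomized algorithm that, given as input $b\in\mathbb{R}^n$ (accessed by probing coordinates), outputs $\hat x_u$ satisfying \[ \Pr\Big[\,|\hat x_u-x^*_u|\le \tfrac15\|x^*\|_\infty\Big]\ \ge\ \tfrac67,\qquad\text{where } x^*=S^{-1}b, \] must probe $n^{\Omega(1/d^2)}$ coordinates of $b$ (in the worst case).
   Context: The sparsity of a matrix is the maximum number of non-zero entries in a single row or column. For a PSD matrix $S$, the condition number $\kappa(S)$ is the ratio between its largest and smallest non-zero eigenvalues. The algorithm knows $S$ and $u$ in advance (it may preprocess $S$ arbitrarily); only probes to coordinates of $b$ are counted. The $\Omega$ hides an absolute constant. *)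

theory Defs
  imports "HOL-Probability.Probability_Measure" "Jordan_Normal_Form.Spectral_Radius"
    "Jordan_Normal_Form.Gauss_Jordan_Elimination"
begin

definition pos_semidef :: "real mat \<Rightarrow> bool" where
  "pos_semidef S \<longleftrightarrow> square_mat S \<and> transpose_mat S = S \<and>
     (\<forall>v \<in> carrier_vec (dim_row S). 0 \<le> v \<bullet> (S *\<^sub>v v))"

definition sparsity :: "real mat \<Rightarrow> nat" where
  "sparsity S = Max
     ((\<lambda>i. card {j. j < dim_col S \<and> S $$ (i, j) \<noteq> 0}) ` {..<dim_row S} \<union>
      (\<lambda>j. card {i. i < dim_row S \<and> S $$ (i, j) \<noteq> 0}) ` {..<dim_col S})"

definition condition_number :: "real mat \<Rightarrow> real" where
  "condition_number S = Max (spectrum S - {0}) / Min (spectrum S - {0})"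

definition linf_norm :: "real vec \<Rightarrow> real" where
  "linf_norm v = Max ((\<lambda>i. \<bar>v $ i\<bar>) ` {..<dim_vec v})"

definition solution :: "real mat \<Rightarrow> real vec \<Rightarrow> real vec" where
  "solution S b = the (mat_inverse S) *\<^sub>v b"

text \<open>Deterministic adaptive algorithms: \<open>Probe i k\<close> reads the coordinate \<open>b $ i\<close> and continues
  with \<open>k (b $ i)\<close>; computation between probes is unrestricted. An index outside the range of
  \<open>b\<close> reveals nothing, as \<open>b $ i\<close> then depends only on the dimension of \<open>b\<close>.\<close>

datatype probe_tree = Output real | Probe nat "real \<Rightarrow> probe_tree"

primrec run :: "probe_tree \<Rightarrow> real vec \<Rightarrow> real" where
  "run (Output r) b = r"
| "run (Probe i k) b = run (k (b $ i)) b"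

primrec probed :: "probe_tree \<Rightarrow> real vec \<Rightarrow> nat set" where
  "probed (Output r) b = {}"
| "probed (Probe i k) b = insert i (probed (k (b $ i)) b)"

text \<open>A randomized algorithm is a probability measure \<open>A\<close> on deterministic ones, with an arbitrary
  \<open>\<sigma>\<close>-algebra. This loses no generality: an algorithm whose coins live in any probability space
  induces its push-forward, with the \<open>\<sigma>\<close>-algebra of all sets having a measurable preimage. A
  non-measurable success event has measure \<open>0\<close> below, so \<open>estimates\<close> entails that
  success is an event for every input.\<close>

definition estimates :: "probe_tree measure \<Rightarrow> real mat \<Rightarrow> nat \<Rightarrow> bool" where
  "estimates A S u \<longleftrightarrow> (\<forall>b \<in> carrier_vec (dim_row S).
     measure A {t \<in> space A.
       \<bar>run t b - solution S b $ u\<bar> \<le> 1 / 5 * linf_norm (solution S b)} \<ge> 6 / 7)"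

text \<open>Worst case over inputs and coin tosses; only distinct coordinates are counted, and coin
  tosses of probability \<open>0\<close> are disregarded, both of which make a lower bound stronger.\<close>

definition probes_at_most :: "probe_tree measure \<Rightarrow> nat \<Rightarrow> nat \<Rightarrow> bool" where
  "probes_at_most A n q \<longleftrightarrow> (\<forall>b \<in> carrier_vec n. AE t in A. card (probed t b) \<le> q)"

end

theory Submission
  imports Defs "HOL-Real_Asymp.Real_Asymp"
begin

text \<open>
  Take \<open>S = F F\<^sup>T\<close> with \<open>F = 1 - N / 32\<close>, where \<open>N\<close> sums over the children in the 64-ary heap on
  \<open>{0..<n}\<close>. Since \<open>N\<close> has norm at most \<open>8\<close>, the eigenvalues of \<open>S\<close> lie in \<open>[(3/4)\<^sup>2, (5/4)\<^sup>2]\<close>.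
  Split the 64 children of every vertex into two halves, which labels the vertices of the 64-ary
  heap by those of the binary heap. For a binary vertex \<open>m\<close>, let \<open>b\<close> be the indicator of all vertices
  labelled \<open>m\<close>. The factor \<open>1 / 32\<close> exactly compensates the 32-fold branching, so the solution of
  \<open>F y = b\<close> is \<open>1\<close> on the vertices labelled by ancestors of \<open>m\<close>, and \<open>S x = b\<close> has a bounded solution
  with value \<open>1\<close> at the root. Telling \<open>b\<close> from \<open>- b\<close> requires a probe in the support of \<open>b\<close>. These
  supports are disjoint for different \<open>m\<close>, and a vertex labelled \<open>m\<close> has index \<open>O(m\<^sup>6)\<close>, so that
  about \<open>n\<^bsup>1/6\<^esup>\<close> values of \<open>m\<close> are available.
\<close>

unbundle no vec_syntax and no inner_syntax

subsection \<open>Probing lower bounds from disjoint supports\<close>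

text \<open>The default entry beyond the end depends on the length only, so such a probe cannot
  separate two inputs.\<close>

lemma vec_index_out_of_range:
  assumes "a \<in> carrier_vec n" "b \<in> carrier_vec n" "n \<le> i"
  shows "a $ i = b $ i"
proof -
  have "dim_vec a = dim_vec b \<Longrightarrow> dim_vec a \<le> i \<Longrightarrow> a $ i = b $ i"
    by transfer (auto simp: mk_vec_def)
  then show ?thesis using assms by auto
qed

lemma run_cong:
  assumes "\<And>i. i \<in> probed t a \<Longrightarrow> a $ i = b $ i"
  shows "run t a = run t b"
  using assms by (induction t) auto

lemma finite_probed: "finite (probed t b)"
  by (induction t) auto

lemma linf_norm_uminus: "linf_norm (- v) = linf_norm v"
  unfolding linf_norm_def by (auto intro!: arg_cong[where f = Max] image_cong)

lemma linf_norm_le: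
  assumes "0 < dim_vec v" "\<And>i. i < dim_vec v \<Longrightarrow> \<bar>v $ i\<bar> \<le> C"
  shows "linf_norm v \<le> C"
  unfolding linf_norm_def using assms by (subst Max_le_iff) auto

lemma invertible_mat_if_kernel_trivial:
  fixes S :: "'a :: field mat"
  assumes S: "S \<in> carrier_mat n n"
    and ker: "\<And>v. v \<in> carrier_vec n \<Longrightarrow> S *\<^sub>v v = 0\<^sub>v n \<Longrightarrow> v = 0\<^sub>v n"
  shows "invertible_mat S"
proof -
  have "det S \<noteq> 0" using det_0_iff_vec_prod_zero_field[OF S] ker by blast
  then have "S \<in> Units (ring_mat TYPE('a) n ())" by (rule det_non_zero_imp_unit[OF S])
  then obtain B where "B \<in> carrier_mat n n" "S * B = 1\<^sub>m n" "B * S = 1\<^sub>m n"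
    by (auto simp: Units_def ring_mat_def)
  then show ?thesis using S unfolding invertible_mat_def inverts_mat_def square_mat.simps by auto
qed

text \<open>As a unit of the matrix ring, \<open>S\<close> has a Gauss-Jordan inverse, so
  \<open>the\<close> in \<open>solution\<close> does not meet \<open>None\<close>.\<close>

lemma solution_eqI:
  assumes S: "S \<in> carrier_mat n n" and inv: "invertible_mat S"
    and x: "x \<in> carrier_vec n" and b: "S *\<^sub>v x = b"
  shows "solution S b = x"
proof -
  obtain B where B: "inverts_mat S B" "inverts_mat B S"
    using inv unfolding invertible_mat_def by blast
  have SB: "S * B = 1\<^sub>m n" using B(1) S by (auto simp: inverts_mat_def)
  \<comment> \<open>The shape of \<open>B\<close> is not part of \<open>invertible_mat\<close>; it
    is read off from the two products.\<close>
  have "dim_col B = n" using arg_cong[OF SB, of dim_col] by simp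
  moreover have BS: "B * S = 1\<^sub>m (dim_row B)" using B(2) by (auto simp: inverts_mat_def)
  moreover have "dim_row B = n" using arg_cong[OF BS, of dim_col] S by simp
  ultimately have "B \<in> carrier_mat n n" "B * S = 1\<^sub>m n" by auto
  then have "S \<in> Units (ring_mat TYPE(real) n ())"
    using S SB by (auto simp: Units_def ring_mat_def)
  then obtain C where "mat_inverse S = Some C"
    using mat_inverse(1)[OF S, of "()"] by (cases "mat_inverse S") auto
  with mat_inverse(2)[OF S] have "mat_inverse S = Some C" "C * S = 1\<^sub>m n" "C \<in> carrier_mat n n"
    by auto
  then show ?thesis unfolding solution_def using b x S
    by (metis assoc_mult_mat_vec one_mult_mat_vec option.sel)
qed

text \<open>Choosing one element of \<open>P\<close> in each set that is hit is injective by
  disjointness.\<close>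

lemma card_hit_le:
  assumes "finite P" "disjoint_family_on T I" "finite I"
  shows "card {i \<in> I. T i \<inter> P \<noteq> {}} \<le> card P"
proof -
  let ?J = "{i \<in> I. T i \<inter> P \<noteq> {}}"
  have "\<forall>i\<in>?J. \<exists>j. j \<in> T i \<inter> P" by auto
  then obtain f where f: "\<And>i. i \<in> ?J \<Longrightarrow> f i \<in> T i \<inter> P" by (metis (no_types, lifting))
  have "inj_on f ?J"
  proof (rule inj_onI)
    fix i j assume "i \<in> ?J" "j \<in> ?J" "f i = f j"
    then show "i = j" using f[of i] f[of j] assms(2)
      unfolding disjoint_family_on_def by (metis (mono_tags, lifting) IntD1 IntI empty_iff mem_Collect_eq)
  qed
  then show ?thesis using f assms(1) by (intro card_inj_on_le) auto
qed

text \<open>An algorithm that is correct on both \<open>S x\<close> and \<open>- S x\<close> has to look at the support of \<open>S x\<close>,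
  and it decides where to look as if the input were \<open>0\<close> until it hits this support.\<close>

lemma probe_lower_bound:
  fixes S :: "real mat" and x :: "'i \<Rightarrow> real vec"
  assumes S: "S \<in> carrier_mat n n" "invertible_mat S" and u: "u < n" and I: "finite I"
    and x: "\<And>i. i \<in> I \<Longrightarrow> x i \<in> carrier_vec n"
    and xu: "\<And>i. i \<in> I \<Longrightarrow> x i $ u = 1"
    and norm: "\<And>i. i \<in> I \<Longrightarrow> linf_norm (x i) < 5"
    and disj: "disjoint_family_on (\<lambda>i. {j. j < n \<and> (S *\<^sub>v x i) $ j \<noteq> 0}) I"
    and A: "prob_space A" "estimates A S u" "probes_at_most A n q"
  shows "5 / 7 * real (card I) \<le> real q"
proof -
  interpret prob_space A by fact
  define T where "T = (\<lambda>i. {j. j < n \<and> (S *\<^sub>v x i) $ j \<noteq> 0})"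
  define G where "G b = {t \<in> space A.
    \<bar>run t b - solution S b $ u\<bar> \<le> 1 / 5 * linf_norm (solution S b)}" for b
  define E where "E i = G (S *\<^sub>v x i) \<inter> G (- (S *\<^sub>v x i))" for i
  have dim: "S *\<^sub>v x i \<in> carrier_vec n" "- (S *\<^sub>v x i) \<in> carrier_vec n" if "i \<in> I" for i
    using mult_mat_vec_carrier[OF S(1) x[OF that]] by auto
  have G67: "prob (G b) \<ge> 6 / 7" if "b \<in> carrier_vec n" for b
    using A(2) that S(1) unfolding estimates_def G_def by auto
  \<comment> \<open>A non-measurable set would have measure \<open>0\<close>, so the bound
    \<open>6 / 7\<close> forces measurability.\<close>
  have Gev: "G b \<in> events" if "b \<in> carrier_vec n" for b
    using G67[OF that] measure_notin_sets[of "G b" A] by fastforce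
  have Eev: "E i \<in> events" if "i \<in> I" for i
    unfolding E_def using Gev dim that by auto
  \<comment> \<open>Inclusion-exclusion: \<open>6 / 7 + 6 / 7 - 1 = 5 / 7\<close>.\<close>
  have E57: "prob (E i) \<ge> 5 / 7" if i: "i \<in> I" for i
  proof -
    have "prob (G (S *\<^sub>v x i) \<union> G (- (S *\<^sub>v x i))) =
        prob (G (S *\<^sub>v x i)) + prob (G (- (S *\<^sub>v x i))) - prob (E i)"
      unfolding E_def using Gev dim i by (intro measure_Un3) (auto simp: fmeasurable_eq_sets)
    then show ?thesis using G67[OF dim(1)[OF i]] G67[OF dim(2)[OF i]] 
        prob_le_1[of "G (S *\<^sub>v x i) \<union> G (- (S *\<^sub>v x i))"]
      by linarith
  qed
  have hit: "T i \<inter> probed t (0\<^sub>v n) \<noteq> {}" if i: "i \<in> I" and t: "t \<in> E i" for i t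
  proof
    assume none: "T i \<inter> probed t (0\<^sub>v n) = {}"
    have "0\<^sub>v n $ j = (S *\<^sub>v x i) $ j \<and>
        0\<^sub>v n $ j = (- (S *\<^sub>v x i)) $ j"
      if j: "j \<in> probed t (0\<^sub>v n)" for j
    proof (cases "j < n")
      case True
      then show ?thesis using none j S(1) by (auto simp: T_def)
    next
      case False
      then show ?thesis using dim[OF i] by (auto intro!: vec_index_out_of_range[of _ n])
    qed
    then have "run t (0\<^sub>v n) = run t (S *\<^sub>v x i)" "run t (0\<^sub>v n) = run t (- (S *\<^sub>v x i))"
      using run_cong[of t "0\<^sub>v n"] by blast+
    then have run: "run t (S *\<^sub>v x i) = run t (- (S *\<^sub>v x i))" by simp
    have sol: "solution S (S *\<^sub>v x i) = x i" "solution S (- (S *\<^sub>v x i)) = - x i"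
    proof -
      show "solution S (S *\<^sub>v x i) = x i" using solution_eqI[OF S x[OF i]] by simp
      have "S *\<^sub>v (- x i) = - (S *\<^sub>v x i)"
        using mult_mat_vec[OF S(1) x[OF i], of "-1"]
        by (simp add: uminus_vec_def smult_vec_def)
      then show "solution S (- (S *\<^sub>v x i)) = - x i"
        using x[OF i] by (intro solution_eqI[OF S]) auto
    qed
    \<comment> \<open>The two solutions are \<open>1\<close> and \<open>- 1\<close> at
      \<open>u\<close> and both errors are below \<open>5 / 5 = 1\<close>, so the common output
      would be positive and negative at once.\<close>
    have "(- x i) $ u = - 1" using xu[OF i] x[OF i] u by auto
    then have "\<bar>run t (S *\<^sub>v x i) - 1\<bar> < 1" "\<bar>run t (S *\<^sub>v x i) + 1\<bar> < 1"
      using t run sol xu[OF i] norm[OF i] unfolding E_def G_def by (auto simp: linf_norm_uminus)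
    then show False by linarith
  qed
  \<comment> \<open>Double counting: every \<open>E i\<close> containing \<open>t\<close> costs a
    distinct probe on input \<open>0\<close>. Integration then bounds the sum of the probabilities
    by \<open>q\<close>.\<close>
  have "AE t in A. (\<Sum>i\<in>I. indicator (E i) t) \<le> real q"
  proof -
    have "AE t in A. card (probed t (0\<^sub>v n)) \<le> q"
      using A(3) unfolding probes_at_most_def by auto
    then show ?thesis
    proof (eventually_elim)
      fix t assume q: "card (probed t (0\<^sub>v n)) \<le> q"
      have "(\<Sum>i\<in>I. indicator (E i) t) = real (card {i \<in> I. t \<in> E i})"
        using I by (simp add: indicator_def of_bool_def sum.If_cases Int_def)
      also have "card {i \<in> I. t \<in> E i} \<le> card {i \<in> I. T i \<inter> probed t (0\<^sub>v n) \<noteq> {}}"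
        using I hit by (intro card_mono) auto
      also have "\<dots> \<le> card (probed t (0\<^sub>v n))"
        using disj I by (intro card_hit_le finite_probed) (simp_all add: T_def)
      finally show "(\<Sum>i\<in>I. indicator (E i) t) \<le> real q" using q by simp
    qed
  qed
  then have "(\<integral>t. (\<Sum>i\<in>I. indicator (E i) t) \<partial>A) \<le> (\<integral>t. real q \<partial>A)"
    using Eev by (intro integral_mono_AE) (auto intro!: integrable_real_indicator simp: emeasure_eq_measure)
  then have "(\<Sum>i\<in>I. prob (E i)) \<le> real q"
    using Eev by (subst (asm) Bochner_Integration.integral_sum)
      (auto intro!: integrable_real_indicator simp: emeasure_eq_measure prob_space)
  moreover have "(\<Sum>i\<in>I. prob (E i)) \<ge> (\<Sum>i\<in>I. 5 / 7)"
    using E57 by (intro sum_mono) auto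
  ultimately show ?thesis by simp
qed

subsection \<open>A well-conditioned matrix from the 64-ary heap\<close>

definition parent :: "nat \<Rightarrow> nat" where
  "parent j = (j - 1) div 64"

definition children :: "nat \<Rightarrow> nat set" where
  "children i = {64 * i + 1..64 * i + 64}"

text \<open>\<open>0 < j\<close> excludes the root, for which truncated subtraction gives
  \<open>parent 0 = 0\<close>.\<close>

lemma mem_children_iff: "j \<in> children i \<longleftrightarrow> 0 < j \<and> parent j = i"
  unfolding children_def parent_def by auto

lemma parent_bounds:
  assumes "0 < j"
  shows "64 * parent j + 1 \<le> j" "j \<le> 64 * parent j + 64"
  using assms mem_children_iff[of j "parent j"] unfolding children_def by auto

lemma parent_less: "0 < j \<Longrightarrow> parent j < j"
  unfolding parent_def by auto

text \<open>Binary heap numbering from \<open>1\<close>. As 64 is even, the parity of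
  \<open>j - 1\<close> is that of the position among the siblings, so 32 siblings go to each
  side.\<close>

function label :: "nat \<Rightarrow> nat" where
  "label j = (if j = 0 then 1 else 2 * label (parent j) + (j - 1) mod 2)"
  by auto
termination by (relation "Wellfounded.measure id") (auto simp: parent_less)

declare label.simps [simp del]

lemma label_0 [simp]: "label 0 = 1"
  by (simp add: label.simps)

lemma label_pos: "0 < label j"
proof (induction j rule: less_induct)
  case (less j)
  then show ?case by (subst label.simps) (auto simp: parent_less)
qed

lemma label_child: "r < 64 \<Longrightarrow> label (64 * i + 1 + r) = 2 * label i + r mod 2"
proof -
  assume "r < 64"
  then have "parent (64 * i + 1 + r) = i" by (simp add: parent_def)
  moreover have "(64 * i + r) mod 2 = r mod 2" by presburger
  ultimately show ?thesis by (subst label.simps) simp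
qed

text \<open>One level down the label at least doubles, so its sixth power gains the factor
  \<open>2 ^ 6 = 64\<close>, the branching number. The summand \<open>2\<close> absorbs the offset:
  \<open>64 * p + 66 \<le> 64 * (p + 2)\<close>.\<close>

lemma le_label_pow: "j + 2 \<le> 2 * label j ^ 6"
proof (induction j rule: less_induct)
  case (less j)
  show ?case
  proof (cases "j = 0")
    case False
    then have "2 * label (parent j) \<le> label j" by (subst (2) label.simps) simp
    then have "(2 * label (parent j)) ^ 6 \<le> label j ^ 6" by (intro power_mono) auto
    moreover have "j \<le> 64 * parent j + 64" using False parent_bounds by simp
    moreover have "parent j + 2 \<le> 2 * label (parent j) ^ 6"
      using less.IH[OF parent_less[of j]] False by simp
    ultimately show ?thesis unfolding power_mult_distrib by simp
  qed simp
qed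

lemma sum_mod_2: "(\<Sum>r<2 * k. g (r mod 2)) = real k * (g 0 + g 1)" for g :: "nat \<Rightarrow> real"
proof (induction k)
  case (Suc k)
  have "2 * k mod 2 = 0" "Suc (2 * k) mod 2 = 1" by presburger+
  with Suc show ?case by (simp add: algebra_simps)
qed simp

text \<open>This 32 is what the entry \<open>- 1 / 32\<close> of \<open>factor\<close>
  cancels.\<close>

lemma sum_children: "(\<Sum>j\<in>children i. f (label j)) = 32 * (f (2 * label i) + f (2 * label i + 1) :: real)"
proof -
  have "(\<Sum>j\<in>children i. f (label j)) = (\<Sum>r<64. f (label (64 * i + 1 + r)))"
    unfolding children_def
    by (intro sum.reindex_bij_witness[of _ "\<lambda>r. 64 * i + 1 + r" "\<lambda>j. j - (64 * i + 1)"]) auto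
  also have "\<dots> = (\<Sum>r<64. f (2 * label i + r mod 2))"
    by (intro sum.cong refl) (simp only: label_child lessThan_iff)
  also have "\<dots> = 32 * (f (2 * label i) + f (2 * label i + 1))"
    using sum_mod_2[of "\<lambda>s. f (2 * label i + s)" 32] by simp
  finally show ?thesis .
qed

section \<open>Ancestors in the binary heap\<close>

definition ancestor :: "nat \<Rightarrow> nat \<Rightarrow> bool" where
  "ancestor i m \<longleftrightarrow> 0 < i \<and> (\<exists>k. m div 2 ^ k = i)"

lemma ancestor_le: "ancestor i m \<Longrightarrow> i \<le> m"
  unfolding ancestor_def by auto

lemma ancestor_1: "0 < m \<Longrightarrow> ancestor 1 m"
proof (induction m rule: less_induct)
  case (less m)
  show ?case
  proof (cases "m = 1")
    case True
    then show ?thesis by (auto simp: ancestor_def intro: exI[of _ 0])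
  next
    case False
    then have "ancestor 1 (m div 2)" using less by auto
    then obtain k where "m div 2 div 2 ^ k = 1" unfolding ancestor_def by auto
    then have "m div 2 ^ Suc k = 1" by (simp add: div_mult2_eq)
    then show ?thesis unfolding ancestor_def by blast
  qed
qed

text \<open>Either no halving is made, or the value before the last halving is one of the two
  numbers whose half is \<open>i\<close>.\<close>

lemma ancestor_iff:
  assumes "0 < i"
  shows "ancestor i m \<longleftrightarrow> i = m \<or> ancestor (2 * i) m \<or> ancestor (2 * i + 1) m"
proof
  assume "ancestor i m"
  then obtain k where k: "m div 2 ^ k = i" unfolding ancestor_def by auto
  show "i = m \<or> ancestor (2 * i) m \<or> ancestor (2 * i + 1) m"
  proof (cases k)
    case (Suc l)
    with k have "m div 2 ^ l div 2 = i" by (metis div_mult2_eq power_Suc2)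
    then have "m div 2 ^ l = 2 * i \<or> m div 2 ^ l = 2 * i + 1" by linarith
    then show ?thesis using assms unfolding ancestor_def by auto
  qed (use k in simp)
next
  have up: "ancestor i m" if c: "ancestor c m" "c div 2 = i" for c
  proof -
    obtain l where "m div 2 ^ l = c" using c(1) unfolding ancestor_def by auto
    then have "m div 2 ^ Suc l = i" using c(2) by (metis div_mult2_eq power_Suc2)
    then show ?thesis using assms unfolding ancestor_def by blast
  qed
  have "ancestor i i" using assms unfolding ancestor_def by (auto intro: exI[of _ 0])
  moreover assume "i = m \<or> ancestor (2 * i) m \<or> ancestor (2 * i + 1) m"
  ultimately show "ancestor i m" using up[of "2 * i"] up[of "2 * i + 1"] by auto
qed

text \<open>The numbers of halvings differ, and more halvings cannot give a larger value: the cases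
  lead to \<open>2 * i + 1 \<le> 2 * i\<close> and to \<open>2 * i \<le> i\<close>.\<close>

lemma ancestor_disjoint: "\<not> (ancestor (2 * i) m \<and> ancestor (2 * i + 1) m)"
proof
  assume "ancestor (2 * i) m \<and> ancestor (2 * i + 1) m"
  then obtain k l where kl: "m div 2 ^ k = 2 * i" "m div 2 ^ l = 2 * i + 1" and i: "0 < i"
    unfolding ancestor_def by auto
  have "k < l \<or> l < k" using kl by (metis n_not_Suc_n Suc_eq_plus1 nat_neq_iff)
  then show False
  proof
    assume "k < l"
    then have "m div 2 ^ l = m div 2 ^ k div 2 ^ (l - k)"
      by (metis div_mult2_eq le_add_diff_inverse less_imp_le power_add)
    moreover have "m div 2 ^ k div 2 ^ (l - k) \<le> m div 2 ^ k" by (rule div_le_dividend)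
    ultimately show False using kl by linarith
  next
    assume "l < k"
    then have "m div 2 ^ k = m div 2 ^ l div 2 ^ (k - l)"
      by (metis div_mult2_eq le_add_diff_inverse less_imp_le power_add)
    moreover have "(2 * i + 1) div 2 ^ (k - l) \<le> (2 * i + 1) div 2 ^ 1"
      using \<open>l < k\<close> by (intro div_le_mono2 power_increasing) auto
    ultimately show False using kl i by simp
  qed
qed

text \<open>The three alternatives exclude each other. This is the row of \<open>F y = b\<close> at
  a vertex labelled \<open>i\<close>, with the factors 32 cancelled.\<close>

lemma ancestor_balance:
  assumes "0 < i"
  shows "of_bool (ancestor i m) = (of_bool (i = m) + of_bool (ancestor (2 * i) m) + of_bool (ancestor (2 * i + 1) m) :: real)"
proof -
  have "\<not> ancestor (2 * i) i" "\<not> ancestor (2 * i + 1) i"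
    using assms ancestor_le[of "2 * i" i] ancestor_le[of "2 * i + 1" i] by auto
  then show ?thesis using ancestor_iff[OF assms, of m] ancestor_disjoint[of i m] by auto
qed

section \<open>The triangular factor and its norm bounds\<close>

definition factor :: "nat \<Rightarrow> real mat" where
  "factor n = mat n n (\<lambda>(i, j). if i = j then 1 else if j \<in> children i then - 1 / 32 else 0)"

lemma factor_carrier [simp]: "factor n \<in> carrier_mat n n" "(factor n)\<^sup>T \<in> carrier_mat n n"
  unfolding factor_def by auto

lemma factor_dim [simp]: "dim_row (factor n) = n" "dim_col (factor n) = n"
  unfolding factor_def by auto

lemma not_mem_children_self: "i \<notin> children i"
  unfolding children_def by auto

lemma finite_children [simp]: "finite (children i)"
  unfolding children_def by auto

lemma factor_mult_index:
  assumes v: "v \<in> carrier_vec n" and i: "i < n"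
  shows "(factor n *\<^sub>v v) $ i = v $ i - (\<Sum>j\<in>children i \<inter> {..<n}. v $ j) / 32"
proof -
  have "(factor n *\<^sub>v v) $ i =
      (\<Sum>j<n. of_bool (i = j) * v $ j - of_bool (j \<in> children i) * (v $ j / 32))"
    using assms not_mem_children_self[of i]
    by (auto simp: factor_def scalar_prod_def atLeast0LessThan intro!: sum.cong)
  also have "\<dots> = (\<Sum>j<n. of_bool (i = j) * v $ j) - (\<Sum>j<n. of_bool (j \<in> children i) * (v $ j / 32))"
    by (rule sum_subtractf)
  also have "(\<Sum>j<n. of_bool (j \<in> children i) * (v $ j / 32)) = (\<Sum>j\<in>{..<n} \<inter> children i. v $ j / 32)"
    unfolding sum.inter_restrict[OF finite_lessThan] by (intro sum.cong) auto
  also have "(\<Sum>j<n. of_bool (i = j) * v $ j) = v $ i"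
    using i by (simp add: of_bool_def if_distrib[of "\<lambda>c. c * _"] cong: if_cong)
  finally show ?thesis by (simp add: sum_divide_distrib Int_commute)
qed

lemma factor_transpose_mult_index:
  assumes v: "v \<in> carrier_vec n" and j: "j < n"
  shows "((factor n)\<^sup>T *\<^sub>v v) $ j = v $ j - (if j = 0 then 0 else v $ parent j / 32)"
proof -
  have "((factor n)\<^sup>T *\<^sub>v v) $ j =
      (\<Sum>i<n. of_bool (i = j) * v $ i - of_bool (j \<in> children i) * (v $ i / 32))"
    using assms not_mem_children_self[of j]
    by (auto simp: factor_def scalar_prod_def atLeast0LessThan intro!: sum.cong)
  also have "\<dots> = (\<Sum>i<n. of_bool (i = j) * v $ i) - (\<Sum>i<n. of_bool (j \<in> children i) * (v $ i / 32))"
    by (rule sum_subtractf)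
  also have "(\<Sum>i<n. of_bool (i = j) * v $ i) = v $ j"
    using j by (simp add: of_bool_def if_distrib[of "\<lambda>c. c * _"] cong: if_cong)
  also have "(\<Sum>i<n. of_bool (j \<in> children i) * (v $ i / 32)) = (if j = 0 then 0 else v $ parent j / 32)"
  proof (cases "j = 0")
    case False
    then have "(\<Sum>i<n. of_bool (j \<in> children i) * (v $ i / 32)) =
        (\<Sum>i<n. if parent j = i then v $ i / 32 else 0)"
      by (intro sum.cong) (auto simp: mem_children_iff)
    also have "\<dots> = v $ parent j / 32" using False j parent_less[of j] by simp
    finally show ?thesis using False by simp
  qed (simp add: mem_children_iff)
  finally show ?thesis .
qed

text \<open>Every vertex is the parent of at most 64 others; this is the norm bound \<open>8\<close>
  for \<open>N\<close>.\<close>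

lemma sum_parent_le:
  fixes f :: "nat \<Rightarrow> real"
  assumes "\<And>i. 0 \<le> f i"
  shows "(\<Sum>j\<in>{0<..<n}. f (parent j)) \<le> 64 * (\<Sum>i<n. f i)"
proof -
  have "(\<Sum>j\<in>{0<..<n}. f (parent j)) = (\<Sum>i<n. \<Sum>j\<in>{j \<in> {0<..<n}. parent j = i}. f (parent j))"
    by (intro sum.group[symmetric]) (auto intro: less_trans[OF parent_less])
  also have "\<dots> \<le> (\<Sum>i<n. 64 * f i)"
  proof (intro sum_mono)
    fix i
    have "{j \<in> {0<..<n}. parent j = i} \<subseteq> children i" by (auto simp: mem_children_iff)
    then have "card {j \<in> {0<..<n}. parent j = i} \<le> 64"
      using card_mono[of "children i"] by (simp add: children_def)
    then show "(\<Sum>j\<in>{j \<in> {0<..<n}. parent j = i}. f (parent j)) \<le> 64 * f i"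
      using assms[of i] by (simp add: mult_right_mono)
  qed
  finally show ?thesis by (simp add: sum_distrib_left)
qed

text \<open>The parent part \<open>p\<close> carries at most \<open>64 / 32\<^sup>2 = 1 / 16\<close>
  of the energy of \<open>v\<close>, a norm ratio of \<open>1 / 4\<close>; the constants are
  \<open>(1 - 1 / 4)\<^sup>2\<close> and \<open>(1 + 1 / 4)\<^sup>2\<close>.\<close>

lemma factor_transpose_energy:
  assumes v: "v \<in> carrier_vec n"
  defines "w \<equiv> (factor n)\<^sup>T *\<^sub>v v"
  shows "9 / 16 * (v \<bullet> v) \<le> w \<bullet> w" "w \<bullet> w \<le> 25 / 16 * (v \<bullet> v)"
proof -
  define p where "p j = (if j = 0 then 0 else v $ parent j / 32)" for j
  have vv: "v \<bullet> v = (\<Sum>j<n. (v $ j)\<^sup>2)"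
    using v by (simp add: scalar_prod_def atLeast0LessThan power2_eq_square)
  have ww: "w \<bullet> w = (\<Sum>j<n. (v $ j - p j)\<^sup>2)"
    using v by (simp add: scalar_prod_def w_def atLeast0LessThan power2_eq_square p_def factor_transpose_mult_index
      del: index_mult_mat_vec)
  have "(\<Sum>j<n. (p j)\<^sup>2) = (\<Sum>j\<in>{0<..<n}. (v $ parent j / 32)\<^sup>2)"
    by (intro sum.mono_neutral_cong_right) (auto simp: p_def)
  also have "\<dots> \<le> 64 * (\<Sum>j<n. (v $ j / 32)\<^sup>2)" by (intro sum_parent_le) simp
  finally have pp: "(\<Sum>j<n. (p j)\<^sup>2) \<le> 1 / 16 * (v \<bullet> v)"
    unfolding vv by (simp add: power_divide sum_divide_distrib[symmetric])
  \<comment> \<open>The mixed term is split with weight 4, the inverse of that ratio; then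
    \<open>3 / 4 - 3 / 16 = 9 / 16\<close>.\<close>
  have "(\<Sum>j<n. 3 / 4 * (v $ j)\<^sup>2 - 3 * (p j)\<^sup>2) \<le> w \<bullet> w"
    unfolding ww
  proof (intro sum_mono)
    fix j
    have "0 \<le> (v $ j - 4 * p j)\<^sup>2" by simp
    then show "3 / 4 * (v $ j)\<^sup>2 - 3 * (p j)\<^sup>2 \<le> (v $ j - p j)\<^sup>2"
      by (simp add: power2_eq_square algebra_simps)
  qed
  then show "9 / 16 * (v \<bullet> v) \<le> w \<bullet> w"
    using pp unfolding sum_subtractf sum_distrib_left[symmetric] vv[symmetric] by simp
  \<comment> \<open>The same weight with the opposite sign:
    \<open>5 / 4 + 5 / 16 = 25 / 16\<close>.\<close>
  have "w \<bullet> w \<le> (\<Sum>j<n. 5 / 4 * (v $ j)\<^sup>2 + 5 * (p j)\<^sup>2)"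
    unfolding ww
  proof (intro sum_mono)
    fix j
    have "0 \<le> (v $ j + 4 * p j)\<^sup>2" by simp
    then show "(v $ j - p j)\<^sup>2 \<le> 5 / 4 * (v $ j)\<^sup>2 + 5 * (p j)\<^sup>2"
      by (simp add: power2_eq_square algebra_simps)
  qed
  then show "w \<bullet> w \<le> 25 / 16 * (v \<bullet> v)"
    using pp unfolding sum.distrib sum_distrib_left[symmetric] vv[symmetric] by simp
qed

section \<open>The matrix \<open>F F\<^sup>T\<close>: spectrum and sparsity\<close>

definition tree_matrix :: "nat \<Rightarrow> real mat" where
  "tree_matrix n = factor n * (factor n)\<^sup>T"

lemma tree_matrix_carrier [simp]: "tree_matrix n \<in> carrier_mat n n"
  unfolding tree_matrix_def by auto

lemma tree_matrix_dim [simp]: "dim_row (tree_matrix n) = n" "dim_col (tree_matrix n) = n"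
  unfolding tree_matrix_def by auto

lemma tree_matrix_mult:
  "v \<in> carrier_vec n \<Longrightarrow> tree_matrix n *\<^sub>v v = factor n *\<^sub>v ((factor n)\<^sup>T *\<^sub>v v)"
  unfolding tree_matrix_def by (rule assoc_mult_mat_vec) auto

lemma tree_matrix_symmetric: "(tree_matrix n)\<^sup>T = tree_matrix n"
  unfolding tree_matrix_def by (subst transpose_mult[of _ n n]) auto

lemma tree_matrix_quadratic_form:
  assumes v: "v \<in> carrier_vec n"
  shows "v \<bullet> (tree_matrix n *\<^sub>v v) = ((factor n)\<^sup>T *\<^sub>v v) \<bullet> ((factor n)\<^sup>T *\<^sub>v v)"
proof -
  have w: "(factor n)\<^sup>T *\<^sub>v v \<in> carrier_vec n" using v by (intro mult_mat_vec_carrier) auto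
  show ?thesis
    unfolding tree_matrix_mult[OF v] using transpose_vec_mult_scalar[OF factor_carrier(1) w v] by simp
qed

lemma tree_matrix_quadratic_form_bounds:
  assumes v: "v \<in> carrier_vec n"
  shows "9 / 16 * (v \<bullet> v) \<le> v \<bullet> (tree_matrix n *\<^sub>v v)"
    "v \<bullet> (tree_matrix n *\<^sub>v v) \<le> 25 / 16 * (v \<bullet> v)"
  using factor_transpose_energy[OF v] tree_matrix_quadratic_form[OF v] by simp_all

lemma scalar_prod_self_nonneg: "0 \<le> v \<bullet> (v :: real vec)"
  unfolding scalar_prod_def by (intro sum_nonneg) simp

lemma scalar_prod_self_pos:
  assumes "v \<in> carrier_vec n" "v \<noteq> 0\<^sub>v n"
  shows "0 < v \<bullet> (v :: real vec)"
proof -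
  obtain i where "i < n" "v $ i \<noteq> 0" using assms by (metis carrier_vecD eq_vecI index_zero_vec(1,2))
  then show ?thesis using assms unfolding scalar_prod_def
    by (intro sum_pos2[of _ i]) (auto simp: zero_less_mult_iff)
qed

lemma pos_semidef_tree_matrix: "pos_semidef (tree_matrix n)"
  unfolding pos_semidef_def
  using tree_matrix_symmetric tree_matrix_quadratic_form scalar_prod_self_nonneg by simp

lemma invertible_tree_matrix: "invertible_mat (tree_matrix n)"
proof (rule invertible_mat_if_kernel_trivial[OF tree_matrix_carrier])
  fix v assume v: "v \<in> carrier_vec n" and "tree_matrix n *\<^sub>v v = 0\<^sub>v n"
  then have "v \<bullet> v \<le> 0" using tree_matrix_quadratic_form_bounds(1)[OF v] by simp
  then show "v = 0\<^sub>v n" using scalar_prod_self_pos[OF v] by force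
qed

lemma eigenvalue_tree_matrix_bounds:
  assumes "eigenvalue (tree_matrix n) a"
  shows "9 / 16 \<le> a" "a \<le> 25 / 16"
proof -
  obtain v where v: "v \<in> carrier_vec n" "v \<noteq> 0\<^sub>v n" and ev: "tree_matrix n *\<^sub>v v = a \<cdot>\<^sub>v v"
    using assms unfolding eigenvalue_def eigenvector_def by auto
  have "v \<bullet> (tree_matrix n *\<^sub>v v) = a * (v \<bullet> v)"
    unfolding ev using v by simp
  moreover have "0 < v \<bullet> v" using scalar_prod_self_pos[OF v] .
  ultimately show "9 / 16 \<le> a" "a \<le> 25 / 16"
    using tree_matrix_quadratic_form_bounds[OF v(1)] mult_le_cancel_right_pos by auto
qed

text \<open>The difference of two sibling leaves is annihilated by \<open>(factor n)\<^sup>T - 1\<close> and \<open>factor n - 1\<close>.\<close>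

lemma eigenvalue_tree_matrix_1:
  assumes n: "67 \<le> n"
  shows "eigenvalue (tree_matrix n) 1"
proof -
  \<comment> \<open>The last vertex with two children below \<open>n\<close>. By
    \<open>67 \<le> n\<close> it is not the root, which makes these children leaves.\<close>
  define p where "p = (n - 3) div 64"
  define a where "a = 64 * p + 1"
  have p1: "1 \<le> p" and an: "a + 1 < n" and "n \<le> 64 * p + 66"
    using n unfolding p_def a_def by auto
  then have leaf: "n \<le> 64 * a + 1" unfolding a_def by simp
  have par: "parent a = p" "parent (a + 1) = p" unfolding parent_def a_def by auto
  define v :: "real vec" where "v = vec n (\<lambda>j. of_bool (j = a) - of_bool (j = a + 1))"
  have v: "v \<in> carrier_vec n" unfolding v_def by simp
  have "(factor n)\<^sup>T *\<^sub>v v = v"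
  proof (rule eq_vecI)
    fix j assume "j < dim_vec v"
    then have j: "j < n" by (simp add: v_def)
    have "v $ parent j = 0" if "0 < j"
    proof -
      have "parent j < n" using parent_less[OF that] j by simp
      moreover have "64 * parent j + 1 \<le> j" using parent_bounds that by simp
      then have "parent j \<noteq> a" "parent j \<noteq> a + 1" using leaf j by auto
      ultimately show ?thesis by (simp add: v_def)
    qed
    then show "((factor n)\<^sup>T *\<^sub>v v) $ j = v $ j"
      unfolding factor_transpose_mult_index[OF v j] by simp
  qed (simp add: v_def)
  moreover have "factor n *\<^sub>v v = v"
  proof (rule eq_vecI)
    fix i assume "i < dim_vec v"
    then have i: "i < n" by (simp add: v_def)
    have "(\<Sum>j\<in>children i \<inter> {..<n}. v $ j) = (\<Sum>j\<in>children i \<inter> {..<n}. of_bool (j = a) - of_bool (j = a + 1))"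
      by (intro sum.cong) (auto simp: v_def)
    also have "\<dots> = of_bool (a \<in> children i) - of_bool (a + 1 \<in> children i)"
      using an by (simp add: sum_subtractf of_bool_def)
    also have "\<dots> = 0" using par by (simp add: mem_children_iff a_def)
    finally show "(factor n *\<^sub>v v) $ i = v $ i" unfolding factor_mult_index[OF v i] by simp
  qed (simp add: v_def)
  ultimately have "tree_matrix n *\<^sub>v v = 1 \<cdot>\<^sub>v v" using tree_matrix_mult[OF v] by simp
  moreover have "v \<noteq> 0\<^sub>v n"
  proof
    assume "v = 0\<^sub>v n"
    then have "v $ a = 0" using an by simp
    then show False using an by (simp add: v_def)
  qed
  ultimately show ?thesis using v unfolding eigenvalue_def eigenvector_def by auto
qed

lemma condition_number_tree_matrix:
  assumes "67 \<le> n"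
  shows "condition_number (tree_matrix n) \<le> 3"
proof -
  define E where "E = spectrum (tree_matrix n) - {0}"
  have fin: "finite E" unfolding E_def using card_finite_spectrum(1)[OF tree_matrix_carrier] by simp
  \<comment> \<open>\<open>Max\<close> and \<open>Min\<close> are unspecified on the empty set, so a
    real eigenvalue has to be exhibited.\<close>
  have ne: "E \<noteq> {}" unfolding E_def spectrum_def using eigenvalue_tree_matrix_1[OF assms] by auto
  have bounds: "9 / 16 \<le> a \<and> a \<le> 25 / 16" if "a \<in> E" for a
    using that eigenvalue_tree_matrix_bounds unfolding E_def spectrum_def by auto
  have "Max E \<le> 25 / 16" "9 / 16 \<le> Min E" using fin ne bounds by auto
  then have "Max E / Min E \<le> (25 / 16) / (9 / 16)" by (intro frac_le) auto
  also have "\<dots> \<le> 3" by simp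
  finally show ?thesis unfolding condition_number_def E_def[symmetric] by simp
qed

text \<open>Rows \<open>i\<close> and \<open>j\<close> of \<open>factor\<close> have to overlap.
  Distinct vertices share no child, so siblings do not interact.\<close>

lemma tree_matrix_nonzero_imp:
  assumes i: "i < n" and j: "j < n" and nz: "tree_matrix n $$ (i, j) \<noteq> 0"
  shows "j \<in> {i, parent i} \<union> children i"
proof -
  have "tree_matrix n $$ (i, j) = (\<Sum>k<n. factor n $$ (i, k) * factor n $$ (j, k))"
    using i j unfolding tree_matrix_def by (simp add: scalar_prod_def atLeast0LessThan)
  with nz obtain k where "k < n" "factor n $$ (i, k) \<noteq> 0" "factor n $$ (j, k) \<noteq> 0"
    by (metis (no_types, lifting) lessThan_iff mult_zero_left mult_zero_right sum.neutral)
  then have "k = i \<or> k \<in> children i" "k = j \<or> k \<in> children j"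
    using i j unfolding factor_def by (auto split: if_splits)
  then show ?thesis by (auto simp: mem_children_iff)
qed

lemma card_tree_matrix_row:
  assumes "i < n"
  shows "card {j. j < n \<and> tree_matrix n $$ (i, j) \<noteq> 0} \<le> 66"
proof -
  have "card {j. j < n \<and> tree_matrix n $$ (i, j) \<noteq> 0} \<le> card ({i, parent i} \<union> children i)"
    using tree_matrix_nonzero_imp[OF assms] by (intro card_mono) auto
  also have "\<dots> \<le> card {i, parent i} + card (children i)" by (rule card_Un_le)
  also have "\<dots> \<le> 66" using card_insert_le_m1[of 2 "{parent i}" i] by (simp add: children_def)
  finally show ?thesis .
qed

lemma sparsity_tree_matrix:
  assumes n: "0 < n"
  shows "sparsity (tree_matrix n) \<le> 66"
proof -
  have sym: "tree_matrix n $$ (i, j) = tree_matrix n $$ (j, i)" if "i < n" "j < n" for i j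
    using that arg_cong[OF tree_matrix_symmetric, of "\<lambda>M. M $$ (i, j)" n] by simp
  have "{i. i < n \<and> tree_matrix n $$ (i, j) \<noteq> 0} = {i. i < n \<and> tree_matrix n $$ (j, i) \<noteq> 0}" if "j < n" for j
    using sym that by auto
  then show ?thesis using n card_tree_matrix_row unfolding sparsity_def
    by (subst Max_le_iff) auto
qed

text \<open>Putting \<open>y v = 1\<close> on the tree vertices whose label is an ancestor of \<open>m\<close> and \<open>0\<close> elsewhere
  solves \<open>factor n y = b\<close> for the indicator \<open>b\<close> of the vertices labelled \<open>m\<close>, because every
  ancestor other than \<open>m\<close> has exactly 32 children labelled by ancestors.\<close>

definition path_vec :: "nat \<Rightarrow> nat \<Rightarrow> real vec" where
  "path_vec n m = vec n (\<lambda>j. of_bool (ancestor (label j) m))"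

lemma factor_mult_path_vec:
  assumes m: "2 * m ^ 6 < n + 2"
  shows "factor n *\<^sub>v path_vec n m = vec n (\<lambda>j. of_bool (label j = m))"
proof (rule eq_vecI)
  fix i assume "i < dim_vec (vec n (\<lambda>j. of_bool (label j = m) :: real))"
  then have i: "i < n" by simp
  \<comment> \<open>Cutting the heap off at \<open>n\<close> loses no vertex labelled by an ancestor
    of \<open>m\<close>.\<close>
  have "j < n" if "ancestor (label j) m" for j
  proof -
    have "label j ^ 6 \<le> m ^ 6" using ancestor_le[OF that] by (intro power_mono) auto
    then show ?thesis using le_label_pow[of j] m by linarith
  qed
  then have "(\<Sum>j\<in>children i \<inter> {..<n}. path_vec n m $ j) = (\<Sum>j\<in>children i. of_bool (ancestor (label j) m))"
    by (intro sum.mono_neutral_cong_left) (auto simp: path_vec_def)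
  also have "\<dots> = 32 * (of_bool (ancestor (2 * label i) m) + of_bool (ancestor (2 * label i + 1) m))"
    by (rule sum_children)
  finally show "(factor n *\<^sub>v path_vec n m) $ i = vec n (\<lambda>j. of_bool (label j = m)) $ i"
    using i ancestor_balance[OF label_pos, of i m]
    by (subst factor_mult_index) (simp_all add: path_vec_def)
qed simp

text \<open>Forward substitution from the root for the transposed factor: the entries of
  \<open>path_vec\<close> on the way up from \<open>j\<close>, damped by \<open>1 / 32\<close> per
  level.\<close>

function potential :: "nat \<Rightarrow> nat \<Rightarrow> real" where
  "potential m j = of_bool (ancestor (label j) m) + (if j = 0 then 0 else potential m (parent j) / 32)"
  by auto
termination by (relation "Wellfounded.measure snd") (auto simp: parent_less)

declare potential.simps [simp del]

text \<open>The induction closes since \<open>1 + 2 / 32 \<le> 2\<close>; a bound below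
  \<open>5\<close> is what \<open>probe_lower_bound\<close> asks for.\<close>

lemma potential_bounds: "0 \<le> potential m j \<and> potential m j \<le> 2"
proof (induction j rule: less_induct)
  case (less j)
  have "j \<noteq> 0 \<Longrightarrow> 0 \<le> potential m (parent j) \<and> potential m (parent j) \<le> 2"
    using less parent_less[of j] by simp
  then show ?case by (auto simp: potential.simps[of m j])
qed

lemma factor_transpose_mult_potential:
  "(factor n)\<^sup>T *\<^sub>v vec n (potential m) = path_vec n m"
proof (rule eq_vecI)
  fix j assume "j < dim_vec (path_vec n m)"
  then have j: "j < n" by (simp add: path_vec_def)
  show "((factor n)\<^sup>T *\<^sub>v vec n (potential m)) $ j = path_vec n m $ j"
    using j parent_less[of j]
    by (subst factor_transpose_mult_index) (auto simp: path_vec_def potential.simps[of m j])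
qed (simp add: path_vec_def)

lemma tree_matrix_mult_potential:
  assumes "2 * m ^ 6 < n + 2"
  shows "tree_matrix n *\<^sub>v vec n (potential m) = vec n (\<lambda>j. of_bool (label j = m))"
  using factor_mult_path_vec[OF assms] by (simp add: tree_matrix_mult factor_transpose_mult_potential)

section \<open>Choice of parameters for large \<open>n\<close>\<close>

theorem theorem1p2:
  shows "\<exists>(c::real) > 0. \<exists>D n\<^sub>0 :: nat. \<forall>n \<ge> n\<^sub>0. \<exists>S \<in> carrier_mat n n. \<exists>u < n.
    pos_semidef S \<and> invertible_mat S \<and> sparsity S \<le> D \<and> condition_number S \<le> 3 \<and>
    (\<forall>A q. prob_space A \<longrightarrow> estimates A S u \<longrightarrow> probes_at_most A n q \<longrightarrow>
       real q \<ge> real n powr (c / (real (sparsity S))\<^sup>2))"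
proof -
  \<comment> \<open>The exponent \<open>1 / 12\<close> leaves room below \<open>1 / 6\<close> for
    the factor \<open>5 / 7\<close> and for rounding.\<close>
  have "eventually (\<lambda>n. real n powr (1 / 12) \<le> 5 / 7 * ((real n / 2) powr (1 / 6) - 1)) sequentially"
    by real_asymp
  then obtain N where N: "\<And>n. N \<le> n \<Longrightarrow>
      real n powr (1 / 12) \<le> 5 / 7 * ((real n / 2) powr (1 / 6) - 1)"
    unfolding eventually_sequentially by auto
  have "\<exists>S \<in> carrier_mat n n. \<exists>u < n.
      pos_semidef S \<and> invertible_mat S \<and> sparsity S \<le> 66 \<and> condition_number S \<le> 3 \<and>
      (\<forall>A q. prob_space A \<longrightarrow> estimates A S u \<longrightarrow> probes_at_most A n q \<longrightarrow>
         real q \<ge> real n powr ((1 / 12) / (real (sparsity S))\<^sup>2))" if n: "max N 67 \<le> n" for n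
  proof (intro bexI[of _ "tree_matrix n"] exI[of _ 0] conjI allI impI)
    show "0 < n" using n by simp
    show "pos_semidef (tree_matrix n)" by (rule pos_semidef_tree_matrix)
    show "invertible_mat (tree_matrix n)" by (rule invertible_tree_matrix)
    show "sparsity (tree_matrix n) \<le> 66" using n by (intro sparsity_tree_matrix) simp
    show "condition_number (tree_matrix n) \<le> 3" using n by (intro condition_number_tree_matrix) simp
    show "tree_matrix n \<in> carrier_mat n n" by simp
  next
    fix A q
    assume A: "prob_space A" "estimates A (tree_matrix n) 0" "probes_at_most A n q"
    \<comment> \<open>The largest \<open>m\<close> with \<open>2 * m ^ 6 \<le> n\<close>.\<close>
    define Q where "Q = nat \<lfloor>(real n / 2) powr (1 / 6)\<rfloor>"
    have Q: "real Q \<le> (real n / 2) powr (1 / 6)" "(real n / 2) powr (1 / 6) - 1 \<le> real Q"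
      unfolding Q_def using powr_ge_zero[of "real n / 2" "1 / 6"]
      by (simp_all add: of_nat_nat floor_le_iff le_floor_iff)
    have small: "2 * m ^ 6 < n + 2" if "m \<le> Q" for m
    proof -
      have "real m ^ 6 \<le> ((real n / 2) powr (1 / 6)) ^ 6"
        using that Q(1) by (intro power_mono) auto
      also have "\<dots> = real n / 2" using n by (simp add: powr_power)
      finally have "real (2 * m ^ 6) \<le> real n" by simp
      then show ?thesis unfolding of_nat_le_iff by simp
    qed
    have b: "tree_matrix n *\<^sub>v vec n (potential m) = vec n (\<lambda>j. of_bool (label j = m))"
      if "m \<in> {1..Q}" for m
      using that small by (intro tree_matrix_mult_potential) simp
    have "5 / 7 * real (card {1..Q}) \<le> real q"
    proof (rule probe_lower_bound[where x = "\<lambda>m. vec n (potential m)"])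
      show "0 < n" using n by simp
      show "vec n (potential m) $ 0 = 1" if "m \<in> {1..Q}" for m
        using that n ancestor_1[of m] by (simp add: potential.simps[of m 0])
      show "linf_norm (vec n (potential m)) < 5" for m
      proof -
        have "linf_norm (vec n (potential m)) \<le> 2"
          using n potential_bounds[of m] by (intro linf_norm_le) (auto simp: abs_le_iff intro: order_trans[of _ 0])
        then show ?thesis by simp
      qed
      \<comment> \<open>The right-hand sides are indicators of different fibres of
        \<open>label\<close>.\<close>
      show "disjoint_family_on
          (\<lambda>m. {j. j < n \<and> (tree_matrix n *\<^sub>v vec n (potential m)) $ j \<noteq> 0}) {1..Q}"
        unfolding disjoint_family_on_def by (auto simp: b)
    qed (use A invertible_tree_matrix in auto)
    then have "real n powr (1 / 12) \<le> real q" using N[of n] n Q(2) by simp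
    \<comment> \<open>A positive sparsity can only lower the exponent; for sparsity \<open>0\<close>
      the quotient is \<open>0\<close>.\<close>
    moreover have "(1 / 12) / (real (sparsity (tree_matrix n)))\<^sup>2 \<le> (1 / 12 :: real)"
      by (cases "sparsity (tree_matrix n)") (auto simp: divide_le_eq)
    then have "real n powr ((1 / 12) / (real (sparsity (tree_matrix n)))\<^sup>2) \<le> real n powr (1 / 12)"
      using n by (intro powr_mono) auto
    ultimately show "real n powr ((1 / 12) / (real (sparsity (tree_matrix n)))\<^sup>2) \<le> real q"
      by linarith
  qed
  then show ?thesis by (intro exI[of _ "1 / 12 :: real"] exI[of _ "66 :: nat"] exI[of _ "max N 67"] conjI allI impI) auto
qed

end
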